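(* Let $m$ be a positive integer, $a\in\mathbb{Z}$, and let $q>1$ be an integer relatively prime to both $m$ and $\sum_{j=0}^{m-1}(-a)^j$. Let $l\in\{0,1,2,\ldots\}$ and $r\in\mathbb{Z}$. If $n,T$ are positive integers with $\nu_m(q)\mid T$, then $$\sum_{k=0}^n(-1)^k\binom nk\left[\begin{matrix} kT+l\\ r\end{matrix}\right]_m(a)\equiv\frac{(a+1)^l}{m}\left(1-(a+1)^T\right)^n \pmod{q^n}.$$
   Context: For $m\in\mathbb{Z}^+$, $N\in\{0,1,2,\ldots\}$, $r\in\mathbb{Z}$ and $a\in\mathbb{Z}$, $\left[\begin{matrix} N\\ r\end{matrix}\right]_m(a)=\sum_{0\le k\le N,\ k\equiv r \pmod m}\binom Nk a^k$ (with $0^0=1$). For integers $q>1$, $m>0$ with $\gcd(q,m)=1$, write $q=\prod_{s=1}^t p_s^{\alpha_s}$ with distinct primes $p_s$ and $\alpha_s\ge1$, and let $\beta_s$ be the multiplicative order of $p_s$ modulo $m$; then $\nu_m(q)=\operatorname{lcm}[p_1^{\alpha_1-1}(p_1^{\beta_1}-1),\ldots,p_t^{\alpha_t-1}(p_t^{\beta_t}-1)]$. Division by $m$ modulo $q^n$ means multiplication by the inverse of $m$ modulo $q^n$. *)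

theory Defs
  imports "HOL-Number_Theory.Number_Theory"
begin

definition binom_residue_sum :: "nat \<Rightarrow> int \<Rightarrow> nat \<Rightarrow> int \<Rightarrow> int" where
  "binom_residue_sum N r m a =
     (\<Sum>k | k \<le> N \<and> [int k = r] (mod int m). int (N choose k) * a ^ k)"

text \<open>
  Intended for \<open>q > 1\<close> coprime to \<open>m\<close>; then \<open>ord m p\<close> is the multiplicative order of \<open>p\<close>
  modulo \<open>m\<close> for each prime factor \<open>p\<close> of \<open>q\<close> (and equals 1 when \<open>m = 1\<close>).
\<close>
definition nu :: "nat \<Rightarrow> nat \<Rightarrow> nat" where
  "nu m q = (LCM p\<in>prime_factors q. p ^ (multiplicity p q - 1) * (p ^ ord m p - 1))"

end

theory Submission
  imports Defs "HOL-Computational_Algebra.Polynomial"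
begin

text \<open>
  The residue sums \<open>binom_residue_sum N r m a\<close> are sums of the coefficients of \<open>(1 + a X) ^ N\<close> along
  a residue class modulo \<open>m\<close>. Hence the left-hand side is such a sum for the polynomial
  \<open>F = (1 + a X) ^ l * (1 - (1 + a X) ^ T) ^ n\<close>. Put \<open>D = 1 + X + \<dots> + X ^ (m - 1)\<close>.
  For a prime \<open>p\<close> dividing \<open>q\<close>, the Frobenius map gives \<open>(1 + a X) ^ (p ^ \<beta>) \<equiv> 1 + a X\<close> modulo
  \<open>(p, X ^ m - 1)\<close>, and \<open>1 + a X\<close> is a unit modulo \<open>(p, D)\<close> since its resultant with \<open>D\<close> is, up to sign,
  the sum of the \<open>(- a) ^ j\<close>. Lifting to prime powers and combining the primes yields
  \<open>(1 + a X) ^ T \<equiv> 1\<close> modulo \<open>(q, D)\<close>, so \<open>F = q ^ n * S + D * W\<close>. All residue sums of \<open>D * W\<close> equal \<open>W(1)\<close>,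
  while evaluating \<open>F\<close> at \<open>1\<close> gives \<open>m * W(1)\<close> modulo \<open>q ^ n\<close>.
\<close>

section \<open>Ideals generated by two elements\<close>

text \<open>Congruences modulo (c, d) are expressed as membership of a difference. Below, d stays
  fixed while c runs through integers, which are lifted and combined.\<close>

definition ideal2 :: "'a::comm_ring_1 \<Rightarrow> 'a \<Rightarrow> 'a set" where
  "ideal2 c d = {c * s + d * t | s t. True}"

lemma ideal2I: "z = c * s + d * t \<Longrightarrow> z \<in> ideal2 c d"
  by (auto simp: ideal2_def)

lemma ideal2E:
  assumes "z \<in> ideal2 c d"
  obtains s t where "z = c * s + d * t"
  using assms by (auto simp: ideal2_def)

lemma ideal2_add:
  assumes "x \<in> ideal2 c d" "y \<in> ideal2 c d"
  shows "x + y \<in> ideal2 c d"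
proof -
  obtain s t s' t' where "x = c * s + d * t" "y = c * s' + d * t'"
    using assms by (metis ideal2E)
  then show ?thesis
    by (intro ideal2I[where s = "s + s'" and t = "t + t'"]) (simp add: algebra_simps)
qed

lemma ideal2_mult_left:
  assumes "x \<in> ideal2 c d"
  shows "y * x \<in> ideal2 c d"
proof -
  obtain s t where "x = c * s + d * t"
    using assms by (rule ideal2E)
  then show ?thesis
    by (intro ideal2I[where s = "y * s" and t = "y * t"]) (simp add: algebra_simps)
qed

lemma ideal2_mult_right: "x \<in> ideal2 c d \<Longrightarrow> x * y \<in> ideal2 c d"
  using ideal2_mult_left[of x c d y] by (simp add: mult.commute)

lemma ideal2_uminus: "x \<in> ideal2 c d \<Longrightarrow> - x \<in> ideal2 c d"
  using ideal2_mult_left[of x c d "- 1"] by simp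

lemma ideal2_diff: "x \<in> ideal2 c d \<Longrightarrow> y \<in> ideal2 c d \<Longrightarrow> x - y \<in> ideal2 c d"
  using ideal2_add[of x c d "- y"] ideal2_uminus[of y c d] by simp

lemma ideal2_0: "0 \<in> ideal2 c d"
  by (rule ideal2I[of _ _ 0 _ 0]) simp

lemma ideal2_sum: "(\<And>i. i \<in> A \<Longrightarrow> f i \<in> ideal2 c d) \<Longrightarrow> sum f A \<in> ideal2 c d"
  by (induction A rule: infinite_finite_induct) (auto intro: ideal2_add ideal2_0)

lemma ideal2_dvd1: "c dvd x \<Longrightarrow> x \<in> ideal2 c d"
  by (elim dvdE, rule ideal2I[of _ _ _ _ 0]) simp

lemma ideal2_dvd2: "d dvd x \<Longrightarrow> x \<in> ideal2 c d"
  by (elim dvdE, rule ideal2I[of _ _ 0]) simp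

text \<open>Every cross term of the product contains d, so only the first generators multiply. This
  is what turns a congruence modulo (q, d) into one modulo (q^n, d).\<close>

lemma ideal2_mult:
  assumes "x \<in> ideal2 c d" "y \<in> ideal2 c' d"
  shows "x * y \<in> ideal2 (c * c') d"
proof -
  obtain s t s' t' where "x = c * s + d * t" "y = c' * s' + d * t'"
    using assms by (metis ideal2E)
  then show ?thesis
    by (intro ideal2I[where s = "s * s'" and t = "c * s * t' + t * y"]) (simp add: algebra_simps)
qed

lemma ideal2_power: "x \<in> ideal2 c d \<Longrightarrow> x ^ n \<in> ideal2 (c ^ n) d"
  by (induction n) (auto intro: ideal2_mult ideal2_dvd1)

lemma ideal2_power_diff:
  assumes "x - y \<in> ideal2 c d"
  shows "x ^ n - y ^ n \<in> ideal2 c d"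
  using ideal2_mult_right[OF assms] by (simp add: power_diff_sumr2)

lemma ideal2_power_minus_1_dvd:
  assumes "x ^ k - 1 \<in> ideal2 c d" "k dvd n"
  shows "x ^ n - 1 \<in> ideal2 c d"
proof -
  obtain j where "n = k * j"
    using assms(2) ..
  then show ?thesis
    using ideal2_power_diff[OF assms(1), of j] by (simp add: power_mult)
qed

section \<open>Combining coprime moduli and lifting to prime powers\<close>

lemma ideal2_Int_coprime:
  fixes A B :: nat
  assumes "coprime A B" "z \<in> ideal2 (of_nat A) d" "z \<in> ideal2 (of_nat B) d"
  shows "z \<in> ideal2 (of_nat (A * B)) (d :: 'a::comm_ring_1)"
proof -
  obtain u v :: int where uv: "u * int A + v * int B = 1"
    using assms(1) by (metis bezout_int coprime_imp_gcd_eq_1 coprime_int_iff)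
  have 1: "of_int u * of_nat A + of_int v * of_nat B = (1 :: 'a)"
    using arg_cong[OF uv, of of_int] by simp
  have "of_nat A \<in> ideal2 (of_nat A) d" "of_nat B \<in> ideal2 (of_nat B) d"
    by (auto intro: ideal2_dvd1)
  \<comment> \<open>By the Bezout relation, z = u * (A * z) + v * (z * B), and both products lie in
    the ideal of A * B.\<close>
  from ideal2_mult[OF this(1) assms(3)] ideal2_mult[OF assms(2) this(2)]
  have "of_int u * (of_nat A * z) + of_int v * (z * of_nat B) \<in> ideal2 (of_nat (A * B)) d"
    by (auto intro!: ideal2_add ideal2_mult_left)
  also have "of_int u * (of_nat A * z) + of_int v * (z * of_nat B)
      = (of_int u * of_nat A + of_int v * of_nat B) * z"
    by (simp add: algebra_simps)
  finally show ?thesis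
    by (simp add: 1)
qed

lemma ideal2_Int_prod_coprime:
  fixes f :: "'b \<Rightarrow> nat"
  assumes "finite P" "\<And>p p'. p \<in> P \<Longrightarrow> p' \<in> P \<Longrightarrow> p \<noteq> p' \<Longrightarrow> coprime (f p) (f p')"
    and "\<And>p. p \<in> P \<Longrightarrow> z \<in> ideal2 (of_nat (f p)) d"
  shows "z \<in> ideal2 (of_nat (\<Prod>p\<in>P. f p)) d"
  using assms
proof (induction P rule: finite_induct)
  case empty
  then show ?case by (auto intro: ideal2_dvd1)
next
  case (insert p P)
  have "coprime (f p) (\<Prod>p\<in>P. f p)"
    using insert by (intro prod_coprime_right) auto
  then show ?case
    using insert by (auto simp: insert.hyps simp del: of_nat_mult of_nat_prod intro!: ideal2_Int_coprime)
qed

text \<open>In x^p - 1 = (x - 1) * (1 + x + ... + x^(p-1)), each of the p summands of the second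
  factor is 1 modulo (p, d). That factor is therefore p, hence 0, modulo (p, d) and supplies one
  more p.\<close>

lemma ideal2_power_prime_lift:
  assumes "x - 1 \<in> ideal2 (of_nat p ^ Suc i) d"
  shows "x ^ p - 1 \<in> ideal2 (of_nat p ^ Suc (Suc i)) d"
proof -
  have p: "x - 1 \<in> ideal2 (of_nat p) d"
  proof -
    obtain s t where "x - 1 = of_nat p ^ Suc i * s + d * t"
      using assms by (rule ideal2E)
    then show ?thesis
      by (intro ideal2I[where s = "of_nat p ^ i * s" and t = t]) (simp add: mult.assoc)
  qed
  have "(\<Sum>i<p. x ^ i - 1) \<in> ideal2 (of_nat p) d"
    using ideal2_power_diff[OF p] by (intro ideal2_sum) simp
  then have "(\<Sum>i<p. x ^ i - 1) + of_nat p \<in> ideal2 (of_nat p) d"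
    by (intro ideal2_add) (auto intro: ideal2_dvd1)
  then have "(\<Sum>i<p. x ^ i) \<in> ideal2 (of_nat p) d"
    by (simp add: sum_subtractf)
  from ideal2_mult[OF assms this] show ?thesis
    by (simp add: power_diff_1_eq[of x p] mult_ac)
qed

lemma ideal2_power_prime_power_lift:
  assumes "x - 1 \<in> ideal2 (of_nat p) d"
  shows "x ^ (p ^ i) - 1 \<in> ideal2 (of_nat p ^ Suc i) d"
proof (induction i)
  case 0
  then show ?case using assms by simp
next
  case (Suc i)
  from ideal2_power_prime_lift[OF this] show ?case
    by (simp add: power_mult[symmetric] mult.commute)
qed

section \<open>Powers of $1 + aX$\<close>

lemma prime_dvd_one_plus_power_diff:
  fixes z :: "'a::comm_ring_1"
  assumes "prime p"
  shows "of_nat p dvd (1 + z) ^ p - (1 + z ^ p)"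
proof -
  have p: "p > 0" using assms by (simp add: prime_gt_0_nat)
  have "(1 + z) ^ p = (\<Sum>k\<le>p. of_nat (p choose k) * z ^ k)"
    by (subst add.commute, subst binomial_ring) simp
  also have "{..p} = insert 0 (insert p {0<..<p})"
    using p by auto
  also have "(\<Sum>k\<in>\<dots>. of_nat (p choose k) * z ^ k)
      = 1 + (z ^ p + (\<Sum>k\<in>{0<..<p}. of_nat (p choose k) * z ^ k))"
    using p by simp
  finally have "(1 + z) ^ p - (1 + z ^ p) = (\<Sum>k\<in>{0<..<p}. of_nat (p choose k) * z ^ k)"
    by simp
  also have "of_nat p dvd \<dots>"
  proof (intro dvd_sum dvd_mult2)
    fix k assume "k \<in> {0<..<p}"
    then have "p dvd (p choose k)"
      using assms by (intro dvd_choose_prime) auto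
    then show "of_nat p dvd (of_nat (p choose k) :: 'a)"
      by auto
  qed
  finally show ?thesis .
qed

lemma prime_dvd_power_prime_diff:
  fixes a :: int
  assumes "prime p"
  shows "int p dvd a ^ p - a"
proof -
  have p: "p > 0" using assms by (simp add: prime_gt_0_nat)
  \<comment> \<open>The natural residue of a makes \<open>fermat_theorem\<close> applicable.\<close>
  define b where "b = nat (a mod int p)"
  have b: "[int b = a] (mod int p)"
    using p by (simp add: b_def cong_def)
  have "[b ^ p = b] (mod p)"
  proof (cases "p dvd b")
    case True
    then have "p dvd b ^ p" using p by (simp add: dvd_power_same dvd_trans dvd_power)
    then show ?thesis using True by (simp add: cong_def mod_eq_0_iff_dvd dvd_imp_mod_0)
  next
    case False
    have "[b * b ^ (p - 1) = b * 1] (mod p)"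
      by (intro cong_mult cong_refl fermat_theorem assms False)
    then show ?thesis using p by (simp add: power_eq_if)
  qed
  then have "[int b ^ p = int b] (mod int p)"
    by (simp flip: cong_int_iff)
  then have "[a ^ p = a] (mod int p)"
    using b by (meson cong_pow cong_sym cong_trans)
  then show ?thesis
    by (simp add: cong_iff_dvd_diff)
qed

text \<open>Iterated Frobenius map: the power moves onto x, while Fermat's little theorem keeps the
  integer coefficient a unchanged.\<close>

lemma linear_power_prime_power:
  fixes x :: "'a::comm_ring_1"
  assumes "prime p"
  shows "(1 + of_int a * x) ^ (p ^ k) - (1 + of_int a * x ^ (p ^ k)) \<in> ideal2 (of_nat p) d"
proof (induction k)
  case 0
  then show ?case by (simp add: ideal2_0)
next
  case (Suc k)
  let ?y = "x ^ (p ^ k)"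
  have 1: "(1 + of_int a * x) ^ (p ^ Suc k) - (1 + of_int a * ?y) ^ p \<in> ideal2 (of_nat p) d"
    using ideal2_power_diff[OF Suc, of p] by (simp add: power_mult[symmetric] mult.commute)
  have 2: "(1 + of_int a * ?y) ^ p - (1 + (of_int a * ?y) ^ p) \<in> ideal2 (of_nat p) d"
    using prime_dvd_one_plus_power_diff[OF assms] by (intro ideal2_dvd1)
  have "of_nat p dvd (of_int (a ^ p - a) :: 'a)"
    using prime_dvd_power_prime_diff[OF assms, of a] by (elim dvdE) simp
  then have 3: "of_int (a ^ p - a) * ?y ^ p \<in> ideal2 (of_nat p) d"
    by (intro ideal2_dvd1 dvd_mult2)
  have "?y ^ p = x ^ (p ^ Suc k)"
    by (simp add: power_mult[symmetric] mult.commute)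
  with ideal2_add[OF ideal2_add[OF 1 2] 3] show ?case
    by (simp add: algebra_simps power_mult_distrib)
qed

text \<open>Let S be the alternating sum in the hypothesis. It lies in the ideal generated by 1 + a
  x and the geometric sum in x; since S is invertible modulo p, so is 1 + a x modulo p and that
  sum.\<close>

lemma linear_unit_mod_geometric_sum:
  fixes x :: "'a::comm_ring_1" and a :: int
  assumes "coprime (int p) (\<Sum>j<m. (- a) ^ j)"
  obtains v where "(1 + of_int a * x) * v - 1 \<in> ideal2 (of_nat p) (\<Sum>j<m. x ^ j)"
proof (cases "m = 0")
  case True
  \<comment> \<open>The sum is empty, so p is coprime to 0, and the ideal is the whole ring.\<close>
  then have "p = 1" using assms by simp
  show ?thesis by (rule that[OF ideal2_dvd1]) (simp add: \<open>p = 1\<close>)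
next
  case False
  define d where "d = (\<Sum>j<m. x ^ j)"
  define u where "u = 1 + of_int a * x"
  define S where "S = (\<Sum>j<m. (- a) ^ j)"
  \<comment> \<open>Homogenising S by \<open>x ^ (m - 1)\<close> turns -a into -a x, which is 1
    modulo u; the powers of x that remain add up to d.\<close>
  have "x ^ (m - 1) * of_int S - d = (\<Sum>j<m. x ^ (m - 1 - j) * ((- (of_int a * x)) ^ j - 1))"
  proof -
    have "d = (\<Sum>j<m. x ^ (m - Suc j))"
      unfolding d_def by (rule sum.nat_diff_reindex[symmetric])
    moreover have "x ^ (m - 1) * of_int S = (\<Sum>j<m. x ^ (m - 1 - j) * (- (of_int a * x)) ^ j)"
      unfolding S_def of_int_sum sum_distrib_left
    proof (rule sum.cong)
      fix j assume "j \<in> {..<m}"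
      then have "x ^ (m - 1) = x ^ (m - 1 - j) * x ^ j"
        by (simp flip: power_add)
      then show "x ^ (m - 1) * of_int ((- a) ^ j) = x ^ (m - 1 - j) * (- (of_int a * x)) ^ j"
        by (simp add: power_mult_distrib[symmetric] mult.assoc mult.left_commute) (simp add: mult_ac)
    qed simp
    ultimately show ?thesis
      by (simp add: sum_subtractf right_diff_distrib)
  qed
  also have "u dvd \<dots>"
  proof (intro dvd_sum dvd_mult)
    fix j
    have "u dvd - (of_int a * x) - 1"
      by (rule dvdI[of _ _ "- 1"]) (simp add: u_def)
    then show "u dvd (- (of_int a * x)) ^ j - 1"
      by (subst power_diff_1_eq) (rule dvd_mult2)
  qed
  finally obtain g where g: "x ^ (m - 1) * of_int S - d = u * g" ..
  have xm: "x ^ m - 1 = (x - 1) * d"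
    by (simp add: d_def power_diff_1_eq)
  have x: "x ^ m = x * x ^ (m - 1)"
    using False by (simp add: power_eq_if)
  \<comment> \<open>Multiplying the previous relation by x and using x^m = 1 + (x - 1) * d isolates
    S; h collects the cofactors of d.\<close>
  define h where "h = x - of_int S * (x - 1)"
  have S: "of_int S = u * (g * x) + d * h"
  proof -
    have "of_int S = x ^ m * of_int S - (x ^ m - 1) * of_int S"
      by (simp add: algebra_simps)
    also have "x ^ m * of_int S = x * (u * g + d)"
      using g by (simp add: x algebra_simps)
    finally show ?thesis
      by (simp add: xm h_def algebra_simps)
  qed
  obtain b c :: int where "b * int p + c * S = 1"
    using assms unfolding S_def by (metis bezout_int coprime_imp_gcd_eq_1)
  from arg_cong[OF this, of of_int] have 1: "1 = of_int b * of_nat p + of_int c * (u * (g * x) + d * h)"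
    by (simp flip: S)
  have "u * (g * x * of_int c) - 1 = of_nat p * (- of_int b) + d * (- (of_int c * h))"
    by (subst 1) (simp add: algebra_simps)
  then show ?thesis
    using that ideal2I unfolding u_def d_def by blast
qed

text \<open>Since x^m = 1 modulo the geometric sum and m divides p^k - 1, the Frobenius congruence
  reads u^(p^k) = u for u = 1 + a x. The unit u then cancels.\<close>

lemma linear_power_prime_power_minus_1:
  fixes x :: "'a::comm_ring_1"
  assumes "prime p" "[p ^ k = 1] (mod m)" "coprime (int p) (\<Sum>j<m. (- a) ^ j)"
  shows "(1 + of_int a * x) ^ (p ^ k - 1) - 1 \<in> ideal2 (of_nat p) (\<Sum>j<m. x ^ j)"
proof -
  define d where "d = (\<Sum>j<m. x ^ j)"
  define u where "u = 1 + of_int a * x"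
  define P where "P = p ^ k"
  have P: "P > 0" using assms by (simp add: P_def prime_gt_0_nat)
  obtain v where v: "u * v - 1 \<in> ideal2 (of_nat p) d"
    using linear_unit_mod_geometric_sum[OF assms(3), of x] unfolding u_def d_def by metis
  have "m dvd P - 1"
    using assms(2) P by (metis P_def cong_altdef_nat Suc_leI One_nat_def)
  then obtain e where e: "P - 1 = m * e" ..
  have "d dvd x ^ m - 1"
    unfolding d_def power_diff_1_eq by simp
  also have "x ^ m - 1 dvd x ^ (P - 1) - 1"
    unfolding e power_mult by (subst power_diff_1_eq) simp
  finally have "d dvd of_int a * x * (x ^ (P - 1) - 1)"
    by simp
  also have "of_int a * x * (x ^ (P - 1) - 1) = of_int a * x ^ P - of_int a * x"
    using P by (simp add: power_eq_if algebra_simps)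
  finally have "of_int a * x ^ P - of_int a * x \<in> ideal2 (of_nat p) d"
    by (rule ideal2_dvd2)
  from ideal2_add[OF linear_power_prime_power[OF assms(1), of a x k d, folded P_def u_def] this]
  have "u ^ P - u \<in> ideal2 (of_nat p) d"
    by (simp add: u_def algebra_simps)
  \<comment> \<open>Cancelling u: the difference of the next two elements is exactly u^(P-1) -
    1.\<close>
  then have "v * (u ^ P - u) \<in> ideal2 (of_nat p) d"
    by (rule ideal2_mult_left)
  moreover have "(u ^ (P - 1) - 1) * (u * v - 1) \<in> ideal2 (of_nat p) d"
    using v by (rule ideal2_mult_left)
  ultimately have "v * (u ^ P - u) - (u ^ (P - 1) - 1) * (u * v - 1) \<in> ideal2 (of_nat p) d"
    by (rule ideal2_diff)
  moreover have "u ^ P = u * u ^ (P - 1)"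
    using P by (simp add: power_eq_if)
  ultimately show ?thesis
    by (simp add: algebra_simps u_def d_def P_def)
qed

lemma linear_power_minus_1:
  fixes x :: "'a::comm_ring_1"
  assumes "q > 0" "coprime (int q) (\<Sum>j<m. (- a) ^ j)" "nu m q dvd T"
  shows "(1 + of_int a * x) ^ T - 1 \<in> ideal2 (of_nat q) (\<Sum>j<m. x ^ j)"
proof -
  let ?f = "\<lambda>p. p ^ multiplicity p q"
  have "(1 + of_int a * x) ^ T - 1 \<in> ideal2 (of_nat (\<Prod>p\<in>prime_factors q. ?f p)) (\<Sum>j<m. x ^ j)"
  proof (rule ideal2_Int_prod_coprime)
    fix p assume p: "p \<in> prime_factors q"
    then have "prime p" "p dvd q" by auto
    then have "coprime (int p) (\<Sum>j<m. (- a) ^ j)"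
      using assms(2) by (meson coprime_divisors dvd_refl of_nat_dvd_iff)
    \<comment> \<open>The fact \<open>ord\<close> also covers p not coprime to m, where
      \<open>ord m p\<close> is 0 by default.\<close>
    from linear_power_prime_power_minus_1[OF \<open>prime p\<close> ord this]
    have "((1 + of_int a * x) ^ (p ^ ord m p - 1)) ^ (p ^ (multiplicity p q - 1)) - 1
        \<in> ideal2 (of_nat p ^ Suc (multiplicity p q - 1)) (\<Sum>j<m. x ^ j)"
      by (rule ideal2_power_prime_power_lift)
    moreover have "Suc (multiplicity p q - 1) = multiplicity p q"
      using p by (simp add: prime_factors_multiplicity)
    ultimately have "(1 + of_int a * x) ^ (p ^ (multiplicity p q - 1) * (p ^ ord m p - 1)) - 1
        \<in> ideal2 (of_nat (?f p)) (\<Sum>j<m. x ^ j)"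
      by (simp add: power_mult[symmetric] mult.commute)
    moreover have "p ^ (multiplicity p q - 1) * (p ^ ord m p - 1) dvd T"
      using p assms(3) unfolding nu_def by (meson dvd_Lcm dvd_trans imageI)
    ultimately show "(1 + of_int a * x) ^ T - 1 \<in> ideal2 (of_nat (?f p)) (\<Sum>j<m. x ^ j)"
      by (rule ideal2_power_minus_1_dvd)
  next
    fix p p' assume "p \<in> prime_factors q" "p' \<in> prime_factors q" "p \<noteq> p'"
    then show "coprime (?f p) (?f p')"
      by (simp add: primes_coprime in_prime_factors_imp_prime)
  qed simp
  then show ?thesis
    using assms(1) by (simp only: prime_factorization_nat[symmetric])
qed

section \<open>Sums of coefficients along a residue class\<close>

text \<open>The class condition is a weight, not an index set, so the range can be extended to any
  degree bound, as additivity requires.\<close>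

definition residue_coeff_sum :: "nat \<Rightarrow> int \<Rightarrow> int poly \<Rightarrow> int" where
  "residue_coeff_sum m r f = (\<Sum>k\<le>degree f. of_bool [int k = r] (mod int m) * coeff f k)"

lemma residue_coeff_sum_eq:
  assumes "degree f \<le> n"
  shows "residue_coeff_sum m r f = (\<Sum>k\<le>n. of_bool [int k = r] (mod int m) * coeff f k)"
  unfolding residue_coeff_sum_def using assms
  by (intro sum.mono_neutral_left) (auto simp: coeff_eq_0)

lemma residue_coeff_sum_add:
  "residue_coeff_sum m r (f + g) = residue_coeff_sum m r f + residue_coeff_sum m r g"
proof -
  define n where "n = max (degree f) (degree g)"
  have "degree f \<le> n" "degree g \<le> n" "degree (f + g) \<le> n"
    by (auto simp: n_def degree_add_le_max)
  then show ?thesis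
    by (simp add: residue_coeff_sum_eq[of _ n] algebra_simps sum.distrib)
qed

lemma residue_coeff_sum_0: "residue_coeff_sum m r 0 = 0"
  by (simp add: residue_coeff_sum_def)

lemma residue_coeff_sum_sum:
  "residue_coeff_sum m r (\<Sum>i\<in>A. f i) = (\<Sum>i\<in>A. residue_coeff_sum m r (f i))"
  by (induction A rule: infinite_finite_induct)
    (auto simp: residue_coeff_sum_0 residue_coeff_sum_add)

lemma residue_coeff_sum_of_int_mult:
  "residue_coeff_sum m r (of_int c * f) = c * residue_coeff_sum m r f"
proof -
  have "of_int c * f = smult c f"
    by (simp add: of_int_poly)
  then show ?thesis
    by (simp add: residue_coeff_sum_eq[of "smult c f" "degree f"] degree_smult_le
        residue_coeff_sum_def sum_distrib_left mult.left_commute del: sum_of_bool_mult_eq)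
qed

lemma residue_coeff_sum_pCons_0:
  "residue_coeff_sum m r (pCons 0 f) = residue_coeff_sum m (r - 1) f"
proof -
  have "[int (Suc k) = r] (mod int m) \<longleftrightarrow> [int k = r - 1] (mod int m)" for k
    by (simp add: cong_iff_dvd_diff algebra_simps)
  then show ?thesis
    by (simp add: residue_coeff_sum_eq[of "pCons 0 f" "Suc (degree f)"] degree_pCons_le
        sum.atMost_Suc_shift residue_coeff_sum_def del: sum.atMost_Suc of_nat_Suc sum_of_bool_mult_eq)
qed

lemma residue_coeff_sum_X_power_mult:
  "residue_coeff_sum m r ([:0, 1:] ^ j * f) = residue_coeff_sum m (r - int j) f"
  by (induction j arbitrary: r) (simp_all add: residue_coeff_sum_pCons_0 mult.assoc algebra_simps)

text \<open>Multiplying by X^j shifts the class to r - j. For j < m these classes meet each residue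
  exactly once, so every coefficient of f is counted once.\<close>

lemma residue_coeff_sum_geometric_mult:
  assumes "m > 0"
  shows "residue_coeff_sum m r ((\<Sum>j<m. [:0, 1:] ^ j) * f) = poly f 1"
proof -
  have one: "(\<Sum>j<m. of_bool [int k = r - int j] (mod int m)) = (1 :: int)" for k
  proof -
    define i where "i = nat ((r - int k) mod int m)"
    have i: "int i = (r - int k) mod int m"
      using assms by (simp add: i_def)
    have "i < m"
      using assms i by (metis of_nat_less_iff of_nat_0_less_iff pos_mod_bound)
    have "[int k = r - int j] (mod int m) \<longleftrightarrow> j = i" if "j < m" for j
    proof -
      have "[int k = r - int j] (mod int m) \<longleftrightarrow> [int j = r - int k] (mod int m)"
        by (simp add: cong_iff_dvd_diff algebra_simps)
      also have "\<dots> \<longleftrightarrow> int j = int i"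
        using that by (simp add: i cong_def)
      finally show ?thesis by simp
    qed
    then have "(\<Sum>j<m. of_bool [int k = r - int j] (mod int m)) = (\<Sum>j<m. of_bool (j = i) :: int)"
      by (intro sum.cong) auto
    also have "\<dots> = 1"
      using \<open>i < m\<close> by (simp add: of_bool_def)
    finally show ?thesis .
  qed
  have "residue_coeff_sum m r ((\<Sum>j<m. [:0, 1:] ^ j) * f)
      = (\<Sum>j<m. \<Sum>k\<le>degree f. of_bool [int k = r - int j] (mod int m) * coeff f k)"
    by (simp only: sum_distrib_right residue_coeff_sum_sum residue_coeff_sum_X_power_mult)
      (simp only: residue_coeff_sum_def)
  also have "\<dots> = (\<Sum>k\<le>degree f. (\<Sum>j<m. of_bool [int k = r - int j] (mod int m)) * coeff f k)"
    by (subst sum.swap) (simp add: sum_distrib_right)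
  also have "\<dots> = poly f 1"
    by (simp only: one) (simp add: poly_altdef)
  finally show ?thesis .
qed

lemma residue_coeff_sum_linear_power:
  "residue_coeff_sum m r ((1 + of_int a * [:0, 1:]) ^ N) = binom_residue_sum N r m a"
proof -
  have lin: "1 + of_int a * [:0, 1:] = [:1, a:]"
    by (simp add: of_int_poly one_pCons)
  have "degree ([:1, a:] ^ N) \<le> degree [:1, a:] * N"
    by (rule degree_power_le)
  also have "\<dots> \<le> N"
    by simp
  finally have "residue_coeff_sum m r ([:1, a:] ^ N)
      = (\<Sum>k\<le>N. of_bool [int k = r] (mod int m) * (int (N choose k) * a ^ k))"
    by (simp add: residue_coeff_sum_eq coeff_linear_poly_power)
  also have "\<dots> = binom_residue_sum N r m a"
    unfolding binom_residue_sum_def by (rule sum.mono_neutral_cong_right) auto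
  finally show ?thesis
    by (simp only: lin)
qed

section \<open>Two evaluations of F and the final congruence\<close>

theorem theorem1p2:
  fixes m q l n T :: nat and a r :: int
  assumes "m > 0" and "q > 1"
    and "coprime q m"
    and "coprime (int q) (\<Sum>j<m. (- a) ^ j)"
    and "n > 0" and "T > 0"
    and "nu m q dvd T"
  shows "[(\<Sum>k=0..n. (-1) ^ k * int (n choose k) * binom_residue_sum (k * T + l) r m a)
          = (a + 1) ^ l * modular_inverse (int q ^ n) (int m) * (1 - (a + 1) ^ T) ^ n]
         (mod (int q ^ n))"
proof -
  define u :: "int poly" where "u = 1 + of_int a * [:0, 1:]"
  define D :: "int poly" where "D = (\<Sum>j<m. [:0, 1:] ^ j)"
  define F where "F = u ^ l * (1 - u ^ T) ^ n"
  let ?L = "\<Sum>k=0..n. (-1) ^ k * int (n choose k) * binom_residue_sum (k * T + l) r m a"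
  let ?R = "(a + 1) ^ l * (1 - (a + 1) ^ T) ^ n"
  let ?i = "modular_inverse (int q ^ n) (int m)"

  have "(1 - u ^ T) ^ n = (\<Sum>k\<le>n. of_nat (n choose k) * (- (u ^ T)) ^ k)"
    using binomial_ring[of "- (u ^ T)" 1 n] by simp
  also have "\<dots> = (\<Sum>k\<le>n. of_int ((-1) ^ k * int (n choose k)) * u ^ (k * T))"
    by (intro sum.cong refl) (simp add: power_minus[of "u ^ T"] power_mult[symmetric] mult_ac)
  finally have "F = (\<Sum>k=0..n. of_int ((-1) ^ k * int (n choose k)) * u ^ (k * T + l))"
    by (simp add: F_def sum_distrib_left atLeast0AtMost power_add mult_ac)
  then have L: "residue_coeff_sum m r F = ?L"
    by (simp only: residue_coeff_sum_sum residue_coeff_sum_of_int_mult u_def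
        residue_coeff_sum_linear_power)
  have R: "poly F 1 = ?R"
    by (simp add: F_def u_def add.commute)

  have "u ^ T - 1 \<in> ideal2 (of_nat q) D"
    unfolding u_def D_def using assms by (intro linear_power_minus_1) auto
  from ideal2_uminus[OF this] have "F \<in> ideal2 (of_nat q ^ n) D"
    unfolding F_def by (intro ideal2_mult_left ideal2_power) simp
  then obtain S W where F: "F = of_nat q ^ n * S + D * W"
    by (rule ideal2E)
  \<comment> \<open>An integer scalar in this form matches
    \<open>residue_coeff_sum_of_int_mult\<close>.\<close>
  have "F = of_int (int q ^ n) * S + D * W"
    by (simp add: F)
  then have "?L = int q ^ n * residue_coeff_sum m r S + poly W 1"
    using residue_coeff_sum_geometric_mult[OF \<open>m > 0\<close>, of r W] L
    by (simp only: residue_coeff_sum_add residue_coeff_sum_of_int_mult D_def)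
  \<comment> \<open>Here D(1) = m; comparing with the residue sum of F eliminates W(1).\<close>
  moreover have "?R = int q ^ n * poly S 1 + int m * poly W 1"
    unfolding R[symmetric] F by (simp add: D_def poly_sum)
  ultimately have "int m * ?L - ?R = int q ^ n * (int m * residue_coeff_sum m r S - poly S 1)"
    by (simp add: algebra_simps)
  then have mL: "[int m * ?L = ?R] (mod int q ^ n)"
    by (simp add: cong_iff_dvd_diff)
  \<comment> \<open>It remains to divide by m, which is invertible modulo q^n.\<close>
  have "coprime (int m) (int q ^ n)"
    using assms(3) by (simp add: coprime_commute)
  then have "[?i * int m * ?L = 1 * ?L] (mod int q ^ n)"
    by (intro cong_mult cong_refl cong_modular_inverse2)
  then have "[?L = ?i * (int m * ?L)] (mod int q ^ n)"
    by (simp add: cong_sym mult.assoc)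
  also have "[?i * (int m * ?L) = ?i * ?R] (mod int q ^ n)"
    by (rule cong_mult[OF cong_refl mL])
  also have "?i * ?R = (a + 1) ^ l * ?i * (1 - (a + 1) ^ T) ^ n"
    by (simp add: mult_ac)
  finally show ?thesis .
qed

end
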